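(* Let $M$ be a Riemannian manifold with a vector field $\zeta$, a function $\beta\in C(M)$ and a conformal Killing vector field $\tau$, with associated algebra $C(M)\rtimes_\tau\mathbb{R}$ and calculus $\Omega^1(C(M)\rtimes_\tau\mathbb{R})$ as in the context. Let $\mu,\nu\in C(M)$, with $\mu$ and $\mu+\nu$ invertible, obey the first order differential equations \[\tau(\mu)=\beta-(1+\alpha)\mu,\qquad\tau(\nu)=\mu-\alpha\nu.\] Then on a normal ordered element $f(t)=\sum_nf_nt^n$, $f_n\in C(M)$, the calculus obeys \[\theta'f(t)=f(t+\lambda\alpha)\theta',\qquad\mathrm df=\bar{\mathrm d}f+\tfrac\lambda2\theta'\bar\Delta f+(\partial_0f)\,\mathrm dt+\lambda(\Delta_0f)\theta',\] where \[\partial_0f(t)=\frac{f(t)-f(t-\lambda)}\lambda,\] \[\Delta_0f(t)=\frac{\nu f(t+\lambda\alpha)+\mu f\big(t-\lambda(\frac\beta\mu-\alpha)\big)-(\nu+\mu)f\big(t+\lambda(\alpha-\frac\beta{\nu+\mu})\big)}{\lambda^2},\] and one also has \[[\mathrm dt,f]=-\lambda\,\mathrm df+\lambda(\mu+\nu)\left(\frac{f(t+\lambda\alpha)-f\big(t+\lambda(\alpha-\frac\beta{\mu+\nu})\big)}\lambda\right)\theta'.\]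
   Context: $C(M)$: smooth functions; $\bar\Omega^1$: classical 1-forms; $\bar{\mathrm d}$: exterior derivative; $\bar g$: metric; $(\ ,\ )$: inverse metric on 1-forms; $\bar\Delta f=\bar\Delta_{LB}f+\zeta(f)$ with $\bar\Delta_{LB}$ the Laplace-Beltrami operator; $\zeta^*=\bar g(\zeta)$; $n=\dim M$; $\alpha=\frac2n\mathrm{div}(\tau)-1$; $\bar{\mathcal L}$ the Lie derivative; $\lambda$ the nonzero deformation parameter. $C(M)\rtimes_\tau\mathbb{R}$ is generated by $C(M)$ and $t$ with $[f,t]=\lambda\tau(f)$; elements are uniquely written in normal ordered form $\sum_nf_nt^n$ (finite sums, $t$ to the right). For $a\in C(M)$, $f(t+\lambda a):=\sum_nf_n(t+\lambda a)^n$ computed in this algebra, and functions in front multiply from the left. $\bar\Delta f=\sum_n(\bar\Delta f_n)t^n$, $\bar{\mathrm d}f=\sum_n(\bar{\mathrm d}f_n)t^n$. The calculus is the bimodule generated by $\bar\Omega^1,\theta',\mathrm dt$ with, for $\omega\in\bar\Omega^1$, $f\in C(M)$, \[[\omega,f]=\lambda(\omega,\bar{\mathrm d}f)\theta',\quad[\theta',f]=0,\quad[\theta',t]=\alpha\lambda\theta',\quad[f,\mathrm dt]=\lambda\,\mathrm df,\quad[\mathrm dt,t]=\beta\lambda\theta'-\lambda\,\mathrm dt,\] \[[\omega,t]=\lambda(\bar{\mathcal L}_\tau-\mathrm{id})\omega-\lambda^2\tfrac{n-2}4(\bar{\mathrm d}\alpha,\omega)\theta'-\tfrac{\lambda^2}2(\bar{\mathcal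 L}_\tau\zeta^*,\omega)\theta',\] and $\mathrm d$ a derivation with $\mathrm df=\bar{\mathrm d}f+\frac\lambda2(\bar\Delta f)\theta'$ for $f\in C(M)$. *)

theory Defs
  imports "HOL-Analysis.Analysis" "HOL-Library.Function_Algebras"
begin

text \<open>
  Conventions. A manifold is a type \<open>'m\<close> of points (Hausdorff, second countable) with a smooth
  atlas of charts into \<open>real ^ 'n\<close>, so its dimension is \<open>CARD('n)\<close>, which is positive.
  Functions on it take values in a field of scalars \<open>'k\<close> of class \<open>real_normed_field\<close>; up to
  isomorphism the only instances are the real and the complex numbers, and for the latter vector
  fields and forms are the complexified ones and a metric is extended bilinearly.
  Sums and products of functions are the pointwise ones (\<open>HOL-Library.Function_Algebras\<close>).
\<close>

section \<open>Smooth manifolds\<close>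

definition partial_deriv :: "'n \<Rightarrow> (real ^ 'n \<Rightarrow> 'b::real_normed_vector) \<Rightarrow> real ^ 'n \<Rightarrow> 'b" where
  "partial_deriv i f x = frechet_derivative f (at x) (axis i 1)"

primrec Ck_on :: "nat \<Rightarrow> (real ^ 'n) set \<Rightarrow> (real ^ 'n \<Rightarrow> 'b::real_normed_vector) \<Rightarrow> bool" where
  "Ck_on 0 S f \<longleftrightarrow> continuous_on S f"
| "Ck_on (Suc k) S f \<longleftrightarrow>
     (\<forall>x\<in>S. f differentiable (at x)) \<and> (\<forall>i. Ck_on k S (partial_deriv i f))"

text \<open>Only used on open sets.\<close>

definition smooth_on :: "(real ^ 'n) set \<Rightarrow> (real ^ 'n \<Rightarrow> 'b::real_normed_vector) \<Rightarrow> bool" where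
  "smooth_on S f \<longleftrightarrow> (\<forall>k. Ck_on k S f)"

type_synonym ('m, 'n) chart = "'m set \<times> ('m \<Rightarrow> real ^ 'n)"

definition chart_inv :: "('m, 'n) chart \<Rightarrow> real ^ 'n \<Rightarrow> 'm" where
  "chart_inv c = inv_into (fst c) (snd c)"

definition smooth_atlas :: "('m::{t2_space,second_countable_topology}, 'n::finite) chart set \<Rightarrow> bool"
  where
  "smooth_atlas A \<longleftrightarrow>
     (\<Union>c\<in>A. fst c) = UNIV \<and>
     (\<forall>c\<in>A. open (fst c) \<and> open (snd c ` fst c) \<and>
        homeomorphism (fst c) (snd c ` fst c) (snd c) (chart_inv c)) \<and>
     (\<forall>c\<in>A. \<forall>c'\<in>A. smooth_on (snd c ` (fst c \<inter> fst c')) (snd c' \<circ> chart_inv c))"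

definition smooth_functions :: "('m, 'n::finite) chart set \<Rightarrow> ('m \<Rightarrow> 'k::real_normed_field) set" where
  "smooth_functions A = {f. \<forall>c\<in>A. smooth_on (snd c ` fst c) (f \<circ> chart_inv c)}"

definition cst :: "'k \<Rightarrow> 'm \<Rightarrow> 'k" where
  "cst r = (\<lambda>_. r)"

definition invertible_function :: "('m, 'n::finite) chart set \<Rightarrow> ('m \<Rightarrow> 'k::real_normed_field) \<Rightarrow> bool"
  where
  "invertible_function A f \<longleftrightarrow> f \<in> smooth_functions A \<and> (\<exists>h\<in>smooth_functions A. f * h = 1)"

section \<open>Vector fields and one-forms\<close>

text \<open>
  Vector fields are derivations of the algebra of smooth functions, and one-forms are the
  function-linear maps from vector fields to smooth functions. Both are set to zero outside their
  domain, so that equality of the underlying HOL functions is equality of fields and forms.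
\<close>

type_synonym ('m, 'k) vfield = "('m \<Rightarrow> 'k) \<Rightarrow> 'm \<Rightarrow> 'k"
type_synonym ('m, 'k) form = "('m, 'k) vfield \<Rightarrow> 'm \<Rightarrow> 'k"

definition vector_fields ::
    "('m, 'n::finite) chart set \<Rightarrow> ('m, 'k::real_normed_field) vfield set" where
  "vector_fields A = {X.
     (\<forall>f\<in>smooth_functions A. X f \<in> smooth_functions A) \<and>
     (\<forall>f\<in>smooth_functions A. \<forall>h\<in>smooth_functions A. X (f + h) = X f + X h) \<and>
     (\<forall>r. \<forall>f\<in>smooth_functions A. X (cst r * f) = cst r * X f) \<and>
     (\<forall>f\<in>smooth_functions A. \<forall>h\<in>smooth_functions A. X (f * h) = X f * h + f * X h) \<and>
     (\<forall>f. f \<notin> smooth_functions A \<longrightarrow> X f = 0)}"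

definition vf_scale :: "('m \<Rightarrow> 'k::real_normed_field) \<Rightarrow> ('m, 'k) vfield \<Rightarrow> ('m, 'k) vfield" where
  "vf_scale f X = (\<lambda>h. f * X h)"

definition vf_bracket ::
    "('m, 'k::real_normed_field) vfield \<Rightarrow> ('m, 'k) vfield \<Rightarrow> ('m, 'k) vfield" where
  "vf_bracket X Y = (\<lambda>f. X (Y f) - Y (X f))"

definition one_forms ::
    "('m, 'n::finite) chart set \<Rightarrow> ('m, 'k::real_normed_field) form set" where
  "one_forms A = {\<omega>.
     (\<forall>X\<in>vector_fields A. \<omega> X \<in> smooth_functions A) \<and>
     (\<forall>X\<in>vector_fields A. \<forall>Y\<in>vector_fields A. \<omega> (X + Y) = \<omega> X + \<omega> Y) \<and>
     (\<forall>f\<in>smooth_functions A. \<forall>X\<in>vector_fields A. \<omega> (vf_scale f X) = f * \<omega> X) \<and>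
     (\<forall>X. X \<notin> vector_fields A \<longrightarrow> \<omega> X = 0)}"

definition form_scale :: "('m \<Rightarrow> 'k::real_normed_field) \<Rightarrow> ('m, 'k) form \<Rightarrow> ('m, 'k) form" where
  "form_scale f \<omega> = (\<lambda>X. f * \<omega> X)"

definition ext_deriv ::
    "('m, 'n::finite) chart set \<Rightarrow> ('m \<Rightarrow> 'k::real_normed_field) \<Rightarrow> ('m, 'k) form" where
  "ext_deriv A f = (\<lambda>X. if X \<in> vector_fields A then X f else 0)"

definition lie_deriv_form ::
    "('m, 'n::finite) chart set \<Rightarrow> ('m, 'k::real_normed_field) vfield \<Rightarrow> ('m, 'k) form \<Rightarrow> ('m, 'k) form"
  where
  "lie_deriv_form A \<tau> \<omega> =
     (\<lambda>X. if X \<in> vector_fields A then \<tau> (\<omega> X) - \<omega> (vf_bracket \<tau> X) else 0)"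

section \<open>Riemannian metrics\<close>

type_synonym ('m, 'k) metric = "('m, 'k) vfield \<Rightarrow> ('m, 'k) vfield \<Rightarrow> 'm \<Rightarrow> 'k"

definition chart_partial :: "('m, 'n::finite) chart \<Rightarrow> 'n \<Rightarrow> ('m \<Rightarrow> 'k::real_normed_field) \<Rightarrow> 'm \<Rightarrow> 'k" where
  "chart_partial c i f p = partial_deriv i (f \<circ> chart_inv c) (snd c p)"

definition vf_components ::
    "('m, 'n::finite) chart set \<Rightarrow> ('m, 'n) chart \<Rightarrow> ('m, 'k::real_normed_field) vfield \<Rightarrow>
     ('n \<Rightarrow> 'm \<Rightarrow> 'k) \<Rightarrow> bool" where
  "vf_components A c X a \<longleftrightarrow>
     (\<forall>f\<in>smooth_functions A. \<forall>p\<in>fst c. X f p = (\<Sum>i\<in>UNIV. a i p * chart_partial c i f p))"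

definition metric_matrix ::
    "('m, 'n::finite) chart set \<Rightarrow> ('m, 'n) chart \<Rightarrow> ('m, 'k::real_normed_field) metric \<Rightarrow>
     ('m \<Rightarrow> real ^ 'n ^ 'n) \<Rightarrow> bool" where
  "metric_matrix A c g G \<longleftrightarrow>
     (\<forall>X\<in>vector_fields A. \<forall>Y\<in>vector_fields A. \<forall>a b.
        vf_components A c X a \<and> vf_components A c Y b \<longrightarrow>
        (\<forall>p\<in>fst c. g X Y p = (\<Sum>i\<in>UNIV. \<Sum>j\<in>UNIV. of_real (G p $ i $ j) * a i p * b j p)))"

definition riemannian_metric ::
    "('m, 'n::finite) chart set \<Rightarrow> ('m, 'k::real_normed_field) metric \<Rightarrow> bool" where
  "riemannian_metric A g \<longleftrightarrow>
     (\<forall>X\<in>vector_fields A. \<forall>Y\<in>vector_fields A.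
        g X Y \<in> smooth_functions A \<and> g X Y = g Y X) \<and>
     (\<forall>X\<in>vector_fields A. \<forall>Y\<in>vector_fields A. \<forall>Z\<in>vector_fields A.
        g (X + Y) Z = g X Z + g Y Z) \<and>
     (\<forall>f\<in>smooth_functions A. \<forall>X\<in>vector_fields A. \<forall>Y\<in>vector_fields A.
        g (vf_scale f X) Y = f * g X Y) \<and>
     (\<forall>c\<in>A. \<exists>G. metric_matrix A c g G \<and>
        (\<forall>p\<in>fst c. transpose (G p) = G p \<and> (\<forall>v. v \<noteq> 0 \<longrightarrow> v \<bullet> (G p *v v) > 0)))"

text \<open>\<open>flat\<close> is the map written \<open>X \<mapsto> g(X)\<close> from vector fields to one-forms.\<close>

definition flat ::
    "('m, 'n::finite) chart set \<Rightarrow> ('m, 'k::real_normed_field) metric \<Rightarrow> ('m, 'k) vfield \<Rightarrow> ('m, 'k) form"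
  where
  "flat A g X = (\<lambda>Y. if Y \<in> vector_fields A then g X Y else 0)"

definition sharp ::
    "('m, 'n::finite) chart set \<Rightarrow> ('m, 'k::real_normed_field) metric \<Rightarrow> ('m, 'k) form \<Rightarrow> ('m, 'k) vfield"
  where
  "sharp A g \<omega> = (THE X. X \<in> vector_fields A \<and> flat A g X = \<omega>)"

definition inverse_metric ::
    "('m, 'n::finite) chart set \<Rightarrow> ('m, 'k::real_normed_field) metric \<Rightarrow>
     ('m, 'k) form \<Rightarrow> ('m, 'k) form \<Rightarrow> 'm \<Rightarrow> 'k" where
  "inverse_metric A g \<omega> \<eta> = g (sharp A g \<omega>) (sharp A g \<eta>)"

text \<open>
  In every chart, the divergence of \<open>X\<close> is \<open>|G|\<^sup>-\<^sup>1\<^sup>/\<^sup>2 \<partial>\<^sub>i(|G|\<^sup>1\<^sup>/\<^sup>2 X\<^sup>i)\<close> with \<open>|G|\<close> the determinant of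
  the metric.
\<close>

definition has_divergence ::
    "('m, 'n::finite) chart set \<Rightarrow> ('m, 'k::real_normed_field) metric \<Rightarrow> ('m, 'k) vfield \<Rightarrow>
     ('m \<Rightarrow> 'k) \<Rightarrow> bool" where
  "has_divergence A g X h \<longleftrightarrow> h \<in> smooth_functions A \<and>
     (\<forall>c\<in>A. \<exists>G a. metric_matrix A c g G \<and> vf_components A c X a \<and>
        (\<forall>p\<in>fst c. h p =
           (\<Sum>i\<in>UNIV. chart_partial c i (\<lambda>q. of_real (sqrt (det (G q))) * a i q) p)
             / of_real (sqrt (det (G p)))))"

text \<open>
  A vector field on a Riemannian manifold has exactly one divergence, since the local expressions
  agree on overlaps of charts. The value zero is only there to make the operator total, as for
  other operators in HOL-Analysis.
\<close>

definition divergence ::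
    "('m, 'n::finite) chart set \<Rightarrow> ('m, 'k::real_normed_field) metric \<Rightarrow> ('m, 'k) vfield \<Rightarrow> 'm \<Rightarrow> 'k"
  where
  "divergence A g X =
     (if \<exists>h. has_divergence A g X h then SOME h. has_divergence A g X h else 0)"

definition laplace_beltrami ::
    "('m, 'n::finite) chart set \<Rightarrow> ('m, 'k::real_normed_field) metric \<Rightarrow> ('m \<Rightarrow> 'k) \<Rightarrow> 'm \<Rightarrow> 'k" where
  "laplace_beltrami A g f = divergence A g (sharp A g (ext_deriv A f))"

definition zeta_laplacian ::
    "('m, 'n::finite) chart set \<Rightarrow> ('m, 'k::real_normed_field) metric \<Rightarrow> ('m, 'k) vfield \<Rightarrow>
     ('m \<Rightarrow> 'k) \<Rightarrow> 'm \<Rightarrow> 'k" where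
  "zeta_laplacian A g \<zeta> f = laplace_beltrami A g f + \<zeta> f"

text \<open>The factor \<open>\<phi>\<close> is unspecified here; taking traces shows that it is \<open>2/n div(\<tau>)\<close>.\<close>

definition conformal_killing ::
    "('m, 'n::finite) chart set \<Rightarrow> ('m, 'k::real_normed_field) metric \<Rightarrow> ('m, 'k) vfield \<Rightarrow> bool" where
  "conformal_killing A g \<tau> \<longleftrightarrow> \<tau> \<in> vector_fields A \<and>
     (\<exists>\<phi>\<in>smooth_functions A. \<forall>X\<in>vector_fields A. \<forall>Y\<in>vector_fields A.
        \<tau> (g X Y) - g (vf_bracket \<tau> X) Y - g X (vf_bracket \<tau> Y) = \<phi> * g X Y)"

definition conf_alpha ::
    "('m, 'n::finite) chart set \<Rightarrow> ('m, 'k::real_normed_field) metric \<Rightarrow> ('m, 'k) vfield \<Rightarrow> 'm \<Rightarrow> 'k" where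
  "conf_alpha A g \<tau> = cst (2 / of_nat CARD('n)) * divergence A g \<tau> - 1"

section \<open>The algebra \<open>C(M) \<rtimes>\<^sub>\<tau> \<real>\<close>\<close>

text \<open>
  \<open>normal_at \<iota> c N x\<close> is \<open>\<Sum>\<^sub>n\<^sub>\<le>\<^sub>N c\<^sub>n x\<^sup>n\<close>, with the functions embedded by \<open>\<iota>\<close>. So
  \<open>normal_at \<iota> c N t\<close> is a normal ordered element \<open>f(t)\<close> and \<open>shifted \<iota> t \<kappa> c N a\<close> is
  \<open>f(t + \<kappa>a)\<close>. The deformation parameter is called \<open>\<kappa>\<close> throughout.
\<close>

definition normal_at :: "(('m \<Rightarrow> 'k) \<Rightarrow> 'a::ring_1) \<Rightarrow> (nat \<Rightarrow> 'm \<Rightarrow> 'k) \<Rightarrow> nat \<Rightarrow> 'a \<Rightarrow> 'a" where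
  "normal_at \<iota> c N x = (\<Sum>n\<le>N. \<iota> (c n) * x ^ n)"

definition shifted ::
    "(('m \<Rightarrow> 'k::real_normed_field) \<Rightarrow> 'a::ring_1) \<Rightarrow> 'a \<Rightarrow> 'k \<Rightarrow> (nat \<Rightarrow> 'm \<Rightarrow> 'k) \<Rightarrow> nat \<Rightarrow>
     ('m \<Rightarrow> 'k) \<Rightarrow> 'a" where
  "shifted \<iota> t \<kappa> c N a = normal_at \<iota> c N (t + \<iota> (cst \<kappa> * a))"

text \<open>The assumptions determine the algebra \<open>'a\<close> up to unique isomorphism.\<close>

locale semidirect_algebra =
  fixes A :: "('m::{t2_space,second_countable_topology}, 'n::finite) chart set"
    and \<tau> :: "('m, 'k::real_normed_field) vfield"
    and \<kappa> :: 'k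
    and \<iota> :: "('m \<Rightarrow> 'k) \<Rightarrow> 'a::ring_1"
    and t :: 'a
  assumes embed_one: "\<iota> 1 = 1"
    and embed_add: "\<And>f h. f \<in> smooth_functions A \<Longrightarrow> h \<in> smooth_functions A \<Longrightarrow> \<iota> (f + h) = \<iota> f + \<iota> h"
    and embed_mult: "\<And>f h. f \<in> smooth_functions A \<Longrightarrow> h \<in> smooth_functions A \<Longrightarrow> \<iota> (f * h) = \<iota> f * \<iota> h"
    and function_t: "\<And>f. f \<in> smooth_functions A \<Longrightarrow> \<iota> f * t - t * \<iota> f = \<iota> (cst \<kappa> * \<tau> f)"
    and normal_form: "\<And>x. \<exists>!c. (\<forall>n. c n \<in> smooth_functions A) \<and>
                             (\<exists>N. (\<forall>n>N. c n = 0) \<and> x = normal_at \<iota> c N t)"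

section \<open>The calculus\<close>

locale bimodule =
  fixes lact :: "'a::ring_1 \<Rightarrow> 'w::ab_group_add \<Rightarrow> 'w" (infixr "\<rhd>" 72)
    and ract :: "'w \<Rightarrow> 'a \<Rightarrow> 'w" (infixl "\<lhd>" 73)
  assumes lact_one: "1 \<rhd> w = w" and ract_one: "w \<lhd> 1 = w"
    and lact_mult: "(x * y) \<rhd> w = x \<rhd> (y \<rhd> w)" and ract_mult: "w \<lhd> (x * y) = (w \<lhd> x) \<lhd> y"
    and lact_add: "(x + y) \<rhd> w = x \<rhd> w + y \<rhd> w" and ract_add: "w \<lhd> (x + y) = w \<lhd> x + w \<lhd> y"
    and lact_add_right: "x \<rhd> (w + w') = x \<rhd> w + x \<rhd> w'"
    and ract_add_left: "(w + w') \<lhd> x = w \<lhd> x + w' \<lhd> x"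
    and lact_ract: "(x \<rhd> w) \<lhd> y = x \<rhd> (w \<lhd> y)"

text \<open>
  A bimodule of one-forms over the algebra, generated by the images \<open>j \<omega>\<close> of the classical forms,
  by \<open>\<theta>\<close> (that is, \<open>\<theta>'\<close>) and by \<open>dt = d t\<close>, and satisfying the listed commutation relations. The
  left action of functions on classical forms is the classical one, the right action is deformed.
  It is not required that all relations be consequences of the listed ones, so the calculus
  presented by the generators and relations is one of the models.
\<close>

locale semidirect_calculus = bimodule lact ract
  for lact :: "'a::ring_1 \<Rightarrow> 'w::ab_group_add \<Rightarrow> 'w" (infixr "\<rhd>" 72)
    and ract :: "'w \<Rightarrow> 'a \<Rightarrow> 'w" (infixl "\<lhd>" 73) +
  fixes A :: "('m::{t2_space,second_countable_topology}, 'n::finite) chart set"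
    and g :: "('m, 'k::real_normed_field) metric"
    and \<zeta> \<tau> :: "('m, 'k) vfield"
    and \<beta> :: "'m \<Rightarrow> 'k"
    and \<kappa> :: 'k
    and \<iota> :: "('m \<Rightarrow> 'k) \<Rightarrow> 'a"
    and t :: 'a
    and j :: "('m, 'k) form \<Rightarrow> 'w"
    and \<theta> :: 'w
    and d :: "'a \<Rightarrow> 'w"
  assumes scalars_central: "\<iota> (cst r) \<rhd> w = w \<lhd> \<iota> (cst r)"
    and j_add: "\<omega> \<in> one_forms A \<Longrightarrow> \<eta> \<in> one_forms A \<Longrightarrow> j (\<omega> + \<eta>) = j \<omega> + j \<eta>"
    and j_scale: "f \<in> smooth_functions A \<Longrightarrow> \<omega> \<in> one_forms A \<Longrightarrow> j (form_scale f \<omega>) = \<iota> f \<rhd> j \<omega>"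
    and generated: "\<And>S. 0 \<in> S \<Longrightarrow> (\<And>v w. v \<in> S \<Longrightarrow> w \<in> S \<Longrightarrow> v + w \<in> S) \<Longrightarrow>
        (\<And>x w. w \<in> S \<Longrightarrow> x \<rhd> w \<in> S) \<Longrightarrow> (\<And>x w. w \<in> S \<Longrightarrow> w \<lhd> x \<in> S) \<Longrightarrow>
        j ` one_forms A \<subseteq> S \<Longrightarrow> \<theta> \<in> S \<Longrightarrow> d t \<in> S \<Longrightarrow> S = UNIV"
    and d_add: "d (x + y) = d x + d y"
    and d_scalar: "d (\<iota> (cst r) * x) = \<iota> (cst r) \<rhd> d x"
    and d_mult: "d (x * y) = d x \<lhd> y + x \<rhd> d y"
    and d_function: "f \<in> smooth_functions A \<Longrightarrow>
        d (\<iota> f) = j (ext_deriv A f) + \<iota> (cst (\<kappa> / 2) * zeta_laplacian A g \<zeta> f) \<rhd> \<theta>"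
    and form_function: "\<omega> \<in> one_forms A \<Longrightarrow> f \<in> smooth_functions A \<Longrightarrow>
        j \<omega> \<lhd> \<iota> f - \<iota> f \<rhd> j \<omega> = \<iota> (cst \<kappa> * inverse_metric A g \<omega> (ext_deriv A f)) \<rhd> \<theta>"
    and theta_function: "f \<in> smooth_functions A \<Longrightarrow> \<theta> \<lhd> \<iota> f - \<iota> f \<rhd> \<theta> = 0"
    and theta_t: "\<theta> \<lhd> t - t \<rhd> \<theta> = \<iota> (conf_alpha A g \<tau> * cst \<kappa>) \<rhd> \<theta>"
    and function_dt: "f \<in> smooth_functions A \<Longrightarrow> \<iota> f \<rhd> d t - d t \<lhd> \<iota> f = \<iota> (cst \<kappa>) \<rhd> d (\<iota> f)"
    and dt_t: "d t \<lhd> t - t \<rhd> d t = \<iota> (\<beta> * cst \<kappa>) \<rhd> \<theta> - \<iota> (cst \<kappa>) \<rhd> d t"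
    and form_t: "\<omega> \<in> one_forms A \<Longrightarrow>
        j \<omega> \<lhd> t - t \<rhd> j \<omega> =
          \<iota> (cst \<kappa>) \<rhd> j (lie_deriv_form A \<tau> \<omega> - \<omega>)
          - \<iota> (cst (\<kappa>\<^sup>2 * (of_nat CARD('n) - 2) / 4)
               * inverse_metric A g (ext_deriv A (conf_alpha A g \<tau>)) \<omega>) \<rhd> \<theta>
          - \<iota> (cst (\<kappa>\<^sup>2 / 2) * inverse_metric A g (lie_deriv_form A \<tau> (flat A g \<zeta>)) \<omega>) \<rhd> \<theta>"

text \<open>The operators \<open>\<partial>\<^sub>0\<close> and \<open>\<Delta>\<^sub>0\<close>, on the normal ordered element with coefficients \<open>c\<close>.\<close>

definition partial0 ::
    "(('m \<Rightarrow> 'k::real_normed_field) \<Rightarrow> 'a::ring_1) \<Rightarrow> 'a \<Rightarrow> 'k \<Rightarrow> (nat \<Rightarrow> 'm \<Rightarrow> 'k) \<Rightarrow> nat \<Rightarrow> 'a" where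
  "partial0 \<iota> t \<kappa> c N = \<iota> (cst (1 / \<kappa>)) * (normal_at \<iota> c N t - shifted \<iota> t \<kappa> c N (- 1))"

definition Delta0 ::
    "(('m \<Rightarrow> 'k::real_normed_field) \<Rightarrow> 'a::ring_1) \<Rightarrow> 'a \<Rightarrow> 'k \<Rightarrow>
     ('m \<Rightarrow> 'k) \<Rightarrow> ('m \<Rightarrow> 'k) \<Rightarrow> ('m \<Rightarrow> 'k) \<Rightarrow> ('m \<Rightarrow> 'k) \<Rightarrow> (nat \<Rightarrow> 'm \<Rightarrow> 'k) \<Rightarrow> nat \<Rightarrow> 'a" where
  "Delta0 \<iota> t \<kappa> \<alpha> \<beta> \<mu> \<nu> c N = \<iota> (cst (1 / \<kappa>\<^sup>2)) *
     (\<iota> \<nu> * shifted \<iota> t \<kappa> c N \<alpha>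
      + \<iota> \<mu> * shifted \<iota> t \<kappa> c N (\<lambda>p. - (\<beta> p / \<mu> p - \<alpha> p))
      - \<iota> (\<nu> + \<mu>) * shifted \<iota> t \<kappa> c N (\<lambda>p. \<alpha> p - \<beta> p / (\<nu> p + \<mu> p)))"

end

theory Submission
  imports Defs
begin

text \<open>
  Write \<open>X = t + \<kappa>\<alpha>\<close>, \<open>Y = t - \<kappa>(\<beta>/\<mu> - \<alpha>)\<close>, \<open>s = \<mu> + \<nu>\<close> and \<open>Z = t + \<kappa>(\<alpha> - \<beta>/s)\<close>. The form
  \<open>\<theta>\<close> commutes with functions and satisfies \<open>\<theta>t = X\<theta>\<close>, which gives \<open>\<theta>f(t) = f(X)\<theta>\<close> at once.

  The role of the differential equations for \<open>\<mu>\<close> and \<open>\<nu>\<close> is that they amount to the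
  intertwining relations \<open>\<mu>Y = (t - \<kappa>)\<mu>\<close> and \<open>sZ = ts\<close> (\<open>shift_intertwining\<close>). So function
  shifts of \<open>t\<close> are conjugate to constant ones, while \<open>\<mu>(X - Y) = s(X - Z) = \<kappa>\<beta>\<close> is the coefficient
  of \<open>\<theta>\<close> in the commutator of \<open>d t\<close> with \<open>t\<close>. The sums \<open>\<Sum> (t - \<kappa>)\<^sup>i \<kappa>\<beta> X\<^sup>k\<close> and \<open>\<Sum> t\<^sup>i \<kappa>\<beta> X\<^sup>k\<close> over
  \<open>i + k = n - 1\<close> therefore telescope to \<open>\<mu>(X\<^sup>n - Y\<^sup>n)\<close> and \<open>s(X\<^sup>n - Z\<^sup>n)\<close>
  (\<open>twisted_telescope_Suc\<close>). They arise as follows.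

  Moving \<open>t\<^sup>n\<close> through \<open>d t\<close> by means of \<open>(d t)t = (t - \<kappa>)d t + \<kappa>\<beta>\<theta>\<close> produces the first one
  (\<open>dt_power\<close>):
  \[(d t)t^n = (t - \kappa)^n d t + \mu(X^n - Y^n)\theta.\]
  The derivation \<open>E = [d t, _] + \<kappa> d\<close> is zero on functions and equal to \<open>\<kappa>\<beta>\<theta>\<close> at \<open>t\<close>, so that it
  takes \<open>t\<^sup>n\<close> to the second one times \<open>\<theta>\<close> (\<open>inner_defect_power\<close>) and \<open>f(t)\<close> to \<open>s(f(X) - f(Z))\<theta>\<close>. The latter
  is the commutator formula (\<open>commutator_dt_normal_at\<close>). The commutator in \<open>E(t\<^sup>n)\<close> is known from the displayed formula, which
  leaves
  \[\kappa d(t^n) = (t^n - (t - \kappa)^n) d t + (s(X^n - Z^n) - \mu(X^n - Y^n))\theta,\]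
  whose coefficient of \<open>\<theta>\<close> is \<open>\<nu>X\<^sup>n + \<mu>Y\<^sup>n - sZ\<^sup>n\<close>. The Leibniz rule on \<open>f\<^sub>nt\<^sup>n\<close> then yields \<open>d f\<close>
  (\<open>d_normal_at\<close>).
\<close>

section \<open>The algebra of smooth functions\<close>

text \<open>
  Partial derivatives of sums and products are given by the usual rules only at the points of \<open>S\<close>,
  where the operands are differentiable. An inductive argument on \<open>k\<close> has to replace a function by one
  that agrees with it there.
\<close>

lemma partial_deriv_cong:
  assumes "open S" "x \<in> S" "\<And>y. y \<in> S \<Longrightarrow> f y = h y"
  shows "partial_deriv i f x = partial_deriv i h x"
proof -
  have "(f has_derivative D) (at x) \<longleftrightarrow> (h has_derivative D) (at x)" for D
    using has_derivative_transform_within_open[OF _ assms(1,2), of f D UNIV h]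
      has_derivative_transform_within_open[OF _ assms(1,2), of h D UNIV f] assms(3)
    by auto
  then show ?thesis
    by (simp add: partial_deriv_def frechet_derivative_def)
qed

lemma Ck_on_cong:
  assumes "open S" "\<And>y. y \<in> S \<Longrightarrow> f y = h y" "Ck_on k S f"
  shows "Ck_on k S h"
  using assms(2,3)
proof (induction k arbitrary: f h)
  case 0
  then show ?case
    using continuous_on_cong[of S S f h] unfolding Ck_on.simps by blast
next
  case (Suc k)
  have "h differentiable (at x)" if "x \<in> S" for x
  proof -
    have "f differentiable (at x)"
      using Suc.prems(2) that by simp
    then obtain D where "(f has_derivative D) (at x)"
      unfolding differentiable_def by (rule exE)
    from has_derivative_transform_within_open[OF this assms(1) that Suc.prems(1)]
    have "(h has_derivative D) (at x)" .
    then show ?thesis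
      by (auto simp: differentiable_def)
  qed
  moreover have "Ck_on k S (partial_deriv i h)" for i
  proof (rule Suc.IH)
    show "Ck_on k S (partial_deriv i f)"
      using Suc.prems by simp
    show "partial_deriv i f y = partial_deriv i h y" if "y \<in> S" for y
      using partial_deriv_cong[OF assms(1) that, of f h i] Suc.prems(1) by simp
  qed
  ultimately show ?case
    by simp
qed

lemma Ck_on_Suc_imp_Ck_on: "Ck_on (Suc k) S f \<Longrightarrow> Ck_on k S f"
proof (induction k arbitrary: f)
  case 0
  then show ?case
    by (simp add: continuous_at_imp_continuous_on differentiable_imp_continuous_within)
next
  case (Suc k)
  have "Ck_on k S (partial_deriv i f)" for i
    using Suc.prems by (intro Suc.IH) (simp only: Ck_on.simps(2)[of "Suc k"])
  then show ?case
    using Suc.prems by simp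
qed

lemma Ck_on_const: "Ck_on k (S :: (real ^ 'n) set) (\<lambda>x. r)"
proof (induction k arbitrary: r)
  case (Suc k)
  have "partial_deriv i (\<lambda>x :: real ^ 'n. r) = (\<lambda>x. 0)" for i
    by (simp add: partial_deriv_def fun_eq_iff)
  then show ?case
    using Suc by simp
qed simp

lemma Ck_on_add:
  assumes "open S" "Ck_on k S f" "Ck_on k S h"
  shows "Ck_on k S (\<lambda>x. f x + h x)"
  using assms(2,3)
proof (induction k arbitrary: f h)
  case 0
  then show ?case
    by (simp add: continuous_on_add)
next
  case (Suc k)
  have "Ck_on k S (partial_deriv i (\<lambda>x. f x + h x))" for i
  proof (rule Ck_on_cong[OF assms(1)])
    show "Ck_on k S (\<lambda>x. partial_deriv i f x + partial_deriv i h x)"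
      using Suc by simp
    show "partial_deriv i f x + partial_deriv i h x = partial_deriv i (\<lambda>x. f x + h x) x"
      if "x \<in> S" for x
    proof -
      have "(f has_derivative frechet_derivative f (at x)) (at x)"
        and "(h has_derivative frechet_derivative h (at x)) (at x)"
        using Suc.prems that unfolding frechet_derivative_works[symmetric] by simp_all
      then have "((\<lambda>x. f x + h x) has_derivative
          (\<lambda>v. frechet_derivative f (at x) v + frechet_derivative h (at x) v)) (at x)"
        by (rule has_derivative_add)
      from frechet_derivative_at[OF this] show ?thesis
        by (simp add: partial_deriv_def fun_eq_iff)
    qed
  qed
  then show ?case
    using Suc.prems by simp
qed

lemma Ck_on_mult:
  fixes f h :: "real ^ 'n \<Rightarrow> 'k::real_normed_field"
  assumes "open S" "Ck_on k S f" "Ck_on k S h"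
  shows "Ck_on k S (\<lambda>x. f x * h x)"
  using assms(2,3)
proof (induction k arbitrary: f h)
  case 0
  then show ?case
    by (simp add: continuous_on_mult)
next
  case (Suc k)
  have "Ck_on k S (partial_deriv i (\<lambda>x. f x * h x))" for i
  proof (rule Ck_on_cong[OF assms(1)])
    show "Ck_on k S (\<lambda>x. f x * partial_deriv i h x + partial_deriv i f x * h x)"
      using Suc.prems Ck_on_Suc_imp_Ck_on[OF Suc.prems(1)] Ck_on_Suc_imp_Ck_on[OF Suc.prems(2)]
      by (intro Ck_on_add assms(1) Suc.IH) auto
    show "f x * partial_deriv i h x + partial_deriv i f x * h x
        = partial_deriv i (\<lambda>x. f x * h x) x" if "x \<in> S" for x
    proof -
      have "(f has_derivative frechet_derivative f (at x)) (at x)"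
        and "(h has_derivative frechet_derivative h (at x)) (at x)"
        using Suc.prems that unfolding frechet_derivative_works[symmetric] by simp_all
      then have "((\<lambda>x. f x * h x) has_derivative
          (\<lambda>v. f x * frechet_derivative h (at x) v + frechet_derivative f (at x) v * h x)) (at x)"
        by (rule has_derivative_mult)
      from frechet_derivative_at[OF this] show ?thesis
        by (simp add: partial_deriv_def fun_eq_iff)
    qed
  qed
  then show ?case
    using Suc.prems by simp
qed

lemma smooth_functions_cst: "cst r \<in> smooth_functions A"
  by (simp add: smooth_functions_def smooth_on_def cst_def comp_def Ck_on_const)

lemma smooth_functions_add:
  assumes "smooth_atlas A" "f \<in> smooth_functions A" "h \<in> smooth_functions A"
  shows "f + h \<in> smooth_functions A"
proof -
  have "Ck_on k (snd c ` fst c) ((f + h) \<circ> chart_inv c)" if "c \<in> A" for c k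
  proof -
    have "open (snd c ` fst c)"
      using assms(1) that by (auto simp: smooth_atlas_def)
    moreover have "Ck_on k (snd c ` fst c) (f \<circ> chart_inv c)"
      "Ck_on k (snd c ` fst c) (h \<circ> chart_inv c)"
      using assms(2,3) that by (auto simp: smooth_functions_def smooth_on_def)
    ultimately have "Ck_on k (snd c ` fst c) (\<lambda>x. (f \<circ> chart_inv c) x + (h \<circ> chart_inv c) x)"
      by (rule Ck_on_add)
    then show ?thesis
      by (simp add: comp_def)
  qed
  then show ?thesis
    by (simp add: smooth_functions_def smooth_on_def)
qed

lemma smooth_functions_mult:
  assumes "smooth_atlas A" "f \<in> smooth_functions A" "h \<in> smooth_functions A"
  shows "f * h \<in> smooth_functions A"
proof -
  have "Ck_on k (snd c ` fst c) ((f * h) \<circ> chart_inv c)" if "c \<in> A" for c k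
  proof -
    have "open (snd c ` fst c)"
      using assms(1) that by (auto simp: smooth_atlas_def)
    moreover have "Ck_on k (snd c ` fst c) (f \<circ> chart_inv c)"
      "Ck_on k (snd c ` fst c) (h \<circ> chart_inv c)"
      using assms(2,3) that by (auto simp: smooth_functions_def smooth_on_def)
    ultimately have "Ck_on k (snd c ` fst c) (\<lambda>x. (f \<circ> chart_inv c) x * (h \<circ> chart_inv c) x)"
      by (rule Ck_on_mult)
    then show ?thesis
      by (simp add: comp_def)
  qed
  then show ?thesis
    by (simp add: smooth_functions_def smooth_on_def)
qed

lemma smooth_functions_one: "1 \<in> smooth_functions A"
  using smooth_functions_cst[of 1 A] by (simp add: cst_def one_fun_def)

lemma smooth_functions_zero: "0 \<in> smooth_functions A"
  using smooth_functions_cst[of 0 A] by (simp add: cst_def zero_fun_def)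

lemma smooth_functions_minus:
  assumes "smooth_atlas A" "f \<in> smooth_functions A"
  shows "- f \<in> smooth_functions A"
proof -
  have "- f = cst (- 1) * f"
    by (simp add: cst_def fun_eq_iff)
  then show ?thesis
    using smooth_functions_mult[OF assms(1) smooth_functions_cst assms(2)] by simp
qed

lemma smooth_functions_diff:
  assumes "smooth_atlas A" "f \<in> smooth_functions A" "h \<in> smooth_functions A"
  shows "f - h \<in> smooth_functions A"
  using smooth_functions_add[OF assms(1,2) smooth_functions_minus[OF assms(1,3)]] by simp

lemma divergence_smooth: "divergence A g X \<in> smooth_functions A"
proof (cases "\<exists>h. has_divergence A g X h")
  case True
  then have "has_divergence A g X (divergence A g X)"
    unfolding divergence_def using someI_ex[of "has_divergence A g X"] by simp
  then show ?thesis
    by (simp only: has_divergence_def)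
next
  case False
  then show ?thesis
    by (simp add: divergence_def smooth_functions_zero)
qed

lemma zeta_laplacian_smooth:
  assumes "smooth_atlas A" "\<zeta> \<in> vector_fields A" "f \<in> smooth_functions A"
  shows "zeta_laplacian A g \<zeta> f \<in> smooth_functions A"
proof -
  have "\<zeta> f \<in> smooth_functions A"
    using assms(2,3) by (simp add: vector_fields_def)
  then show ?thesis
    unfolding zeta_laplacian_def laplace_beltrami_def
    by (rule smooth_functions_add[OF assms(1) divergence_smooth])
qed

lemma conf_alpha_smooth:
  assumes "smooth_atlas A"
  shows "conf_alpha A g \<tau> \<in> smooth_functions A"
  unfolding conf_alpha_def
  by (rule smooth_functions_diff[OF assms smooth_functions_mult[OF assms smooth_functions_cst
      divergence_smooth] smooth_functions_one])

lemma vector_field_add: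
  assumes "X \<in> vector_fields A" "f \<in> smooth_functions A" "h \<in> smooth_functions A"
  shows "X (f + h) = X f + X h"
  using assms unfolding vector_fields_def mem_Collect_eq by blast

lemma vector_field_cst:
  assumes "X \<in> vector_fields A"
  shows "X (cst r) = 0"
proof -
  have leibniz: "X (1 * 1) = X 1 * 1 + 1 * X 1"
    and scale: "X (cst r * 1) = cst r * X 1"
    using assms smooth_functions_one[of A] unfolding vector_fields_def mem_Collect_eq by blast+
  from leibniz have "X 1 = 0"
    by simp
  with scale show ?thesis
    by simp
qed

section \<open>Twisted telescoping\<close>

lemma intertwining_power:
  fixes u w W :: "'a::monoid_mult"
  assumes "u * W = w * u"
  shows "u * W ^ n = w ^ n * u"
proof (induction n)
  case (Suc n)
  have "u * W ^ Suc n = u * W ^ n * W"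
    by (simp add: power_Suc2 mult.assoc del: power_Suc)
  also have "\<dots> = w ^ Suc n * u"
    by (simp add: Suc assms mult.assoc power_Suc2 del: power_Suc)
  finally show ?case .
qed simp

text \<open>
  By iteration, \<open>u (X\<^sup>n - W\<^sup>n)\<close> is the sum of \<open>w\<^sup>i e X\<^sup>k\<close> over \<open>i + k = n - 1\<close>. The reason is
  that \<open>X\<^sup>n - W\<^sup>n\<close> is the sum of \<open>W\<^sup>i (X - W) X\<^sup>k\<close> in any ring, and that the power of \<open>W\<close> passes to
  the left of \<open>u\<close> as a power of \<open>w\<close>.
\<close>

lemma twisted_telescope_Suc:
  fixes u w W X e :: "'a::ring_1"
  assumes "u * W = w * u" "u * (X - W) = e"
  shows "u * (X ^ Suc n - W ^ Suc n) = u * (X ^ n - W ^ n) * X + w ^ n * e"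
proof -
  have "u * (X ^ Suc n - W ^ Suc n) = u * (X ^ n - W ^ n) * X + u * W ^ n * (X - W)"
    by (simp add: power_Suc2 algebra_simps del: power_Suc)
  also have "u * W ^ n * (X - W) = w ^ n * e"
    by (simp add: intertwining_power[OF assms(1)] assms(2)[symmetric] mult.assoc)
  finally show ?thesis .
qed

section \<open>Functions and polynomials in the generator\<close>

context bimodule
begin

lemma lact_zero [simp]: "0 \<rhd> w = 0"
  using lact_add[of 0 0 w] by simp

lemma lact_zero_right [simp]: "x \<rhd> 0 = 0"
  using lact_add_right[of x 0 0] by simp

lemma ract_zero [simp]: "w \<lhd> 0 = 0"
  using ract_add[of w 0 0] by simp

lemma ract_zero_left [simp]: "0 \<lhd> x = 0"
  using ract_add_left[of 0 0 x] by simp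

lemma lact_minus: "(- x) \<rhd> w = - (x \<rhd> w)"
  using lact_add[of x "- x" w] by (simp add: eq_neg_iff_add_eq_0 add.commute)

lemma lact_minus_right: "x \<rhd> (- w) = - (x \<rhd> w)"
  using lact_add_right[of x w "- w"] by (simp add: eq_neg_iff_add_eq_0 add.commute)

lemma lact_diff: "(x - y) \<rhd> w = x \<rhd> w - y \<rhd> w"
  using lact_add[of x "- y" w] by (simp add: lact_minus)

lemma lact_diff_right: "x \<rhd> (w - w') = x \<rhd> w - x \<rhd> w'"
  using lact_add_right[of x w "- w'"] by (simp add: lact_minus_right)

lemma lact_sum: "sum f I \<rhd> w = (\<Sum>i\<in>I. f i \<rhd> w)"
  by (induction I rule: infinite_finite_induct) (simp_all add: lact_add)

lemma lact_sum_right: "x \<rhd> sum f I = (\<Sum>i\<in>I. x \<rhd> f i)"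
  by (induction I rule: infinite_finite_induct) (simp_all add: lact_add_right)

lemma ract_sum: "w \<lhd> sum f I = (\<Sum>i\<in>I. w \<lhd> f i)"
  by (induction I rule: infinite_finite_induct) (simp_all add: ract_add)

lemma ract_power:
  assumes "w \<lhd> x = y \<rhd> w"
  shows "w \<lhd> x ^ n = y ^ n \<rhd> w"
proof (induction n)
  case (Suc n)
  have "w \<lhd> x ^ Suc n = (w \<lhd> x ^ n) \<lhd> x"
    by (simp add: power_Suc2 ract_mult del: power_Suc)
  also have "\<dots> = y ^ Suc n \<rhd> w"
    by (simp add: Suc assms lact_ract lact_mult power_Suc2 del: power_Suc)
  finally show ?case .
qed (simp add: lact_one ract_one)

end

text \<open>
  The assumptions on \<open>\<zeta>\<close>, \<open>\<tau>\<close> and \<open>\<beta>\<close> make the coefficients in the relations smooth functions, to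
  which the relations apply in turn. A vector field kills constants, so that scalars commute with \<open>t\<close>.
\<close>

locale manifold_calculus =
  semidirect_algebra A \<tau> \<kappa> \<iota> t + semidirect_calculus lact ract A g \<zeta> \<tau> \<beta> \<kappa> \<iota> t j \<theta> d
  for lact :: "'a::ring_1 \<Rightarrow> 'w::ab_group_add \<Rightarrow> 'w" (infixr "\<rhd>" 72)
    and ract :: "'w \<Rightarrow> 'a \<Rightarrow> 'w" (infixl "\<lhd>" 73)
    and A :: "('m::{t2_space,second_countable_topology}, 'n::finite) chart set"
    and g :: "('m, 'k::real_normed_field) metric"
    and \<zeta> \<tau> :: "('m, 'k) vfield"
    and \<beta> :: "'m \<Rightarrow> 'k"
    and \<kappa> :: 'k
    and \<iota> :: "('m \<Rightarrow> 'k) \<Rightarrow> 'a"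
    and t :: 'a
    and j :: "('m, 'k) form \<Rightarrow> 'w"
    and \<theta> :: 'w
    and d :: "'a \<Rightarrow> 'w" +
  assumes atlas: "smooth_atlas A"
    and zeta_field: "\<zeta> \<in> vector_fields A"
    and tau_field: "\<tau> \<in> vector_fields A"
    and beta_smooth: "\<beta> \<in> smooth_functions A"
    and kappa_nonzero: "\<kappa> \<noteq> 0"
begin

abbreviation \<alpha> :: "'m \<Rightarrow> 'k" where "\<alpha> \<equiv> conf_alpha A g \<tau>"

lemmas smooth_intros =
  smooth_functions_cst smooth_functions_one smooth_functions_zero beta_smooth
  conf_alpha_smooth[OF atlas] smooth_functions_add[OF atlas] smooth_functions_mult[OF atlas]
  smooth_functions_minus[OF atlas] smooth_functions_diff[OF atlas]
  zeta_laplacian_smooth[OF atlas zeta_field]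

lemma embed_zero: "\<iota> 0 = 0"
  using embed_add[OF smooth_functions_zero smooth_functions_zero] by simp

lemma embed_minus:
  assumes "f \<in> smooth_functions A"
  shows "\<iota> (- f) = - \<iota> f"
proof -
  have "\<iota> (- f) + \<iota> f = \<iota> (- f + f)"
    by (rule embed_add[symmetric]) (intro smooth_intros assms)+
  then show ?thesis
    by (simp add: embed_zero eq_neg_iff_add_eq_0)
qed

lemma embed_diff:
  assumes "f \<in> smooth_functions A" "h \<in> smooth_functions A"
  shows "\<iota> (f - h) = \<iota> f - \<iota> h"
  using embed_add[OF assms(1) smooth_functions_minus[OF atlas assms(2)]] embed_minus[OF assms(2)]
  by simp

lemma embed_commute:
  assumes "f \<in> smooth_functions A" "h \<in> smooth_functions A"
  shows "\<iota> f * \<iota> h = \<iota> h * \<iota> f"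
  using embed_mult[OF assms] embed_mult[OF assms(2,1)] by (simp add: mult.commute)

lemma scalar_commute_t: "\<iota> (cst r) * t = t * \<iota> (cst r)"
  using function_t[OF smooth_functions_cst, of r] vector_field_cst[OF tau_field, of r]
  by (simp add: embed_zero)

lemma scalar_commute_power: "\<iota> (cst r) * t ^ n = t ^ n * \<iota> (cst r)"
  by (rule intertwining_power[OF scalar_commute_t])

lemma scalar_mult: "\<iota> (cst r) * \<iota> (cst s) = \<iota> (cst (r * s))"
proof -
  have "cst (r * s) = cst r * (cst s :: 'm \<Rightarrow> 'k)"
    by (simp add: cst_def fun_eq_iff)
  then show ?thesis
    by (simp add: embed_mult smooth_intros)
qed

lemma scalar_one: "\<iota> (cst 1) = 1"
proof -
  have "cst 1 = (1 :: 'm \<Rightarrow> 'k)"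
    by (simp add: cst_def fun_eq_iff)
  then show ?thesis
    by (simp add: embed_one)
qed

text \<open>
  Functions commute with the coefficients, so a factor in front of a normal ordered element may be
  moved next to the powers, which is where the intertwining relations apply.
\<close>

lemma function_normal_at:
  assumes "u \<in> smooth_functions A" "\<And>n. c n \<in> smooth_functions A"
  shows "\<iota> u * normal_at \<iota> c N x = (\<Sum>n\<le>N. \<iota> (c n) * (\<iota> u * x ^ n))"
  unfolding normal_at_def sum_distrib_left
  by (intro sum.cong refl) (metis mult.assoc embed_commute assms)

section \<open>Moving the generator through one-forms\<close>

abbreviation theta_shift :: 'a where "theta_shift \<equiv> t + \<iota> (cst \<kappa> * \<alpha>)"

lemma theta_power: "\<theta> \<lhd> t ^ n = theta_shift ^ n \<rhd> \<theta>"
proof (rule ract_power)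
  show "\<theta> \<lhd> t = theta_shift \<rhd> \<theta>"
    using theta_t by (simp add: lact_add algebra_simps)
qed

lemma theta_embed: "f \<in> smooth_functions A \<Longrightarrow> \<theta> \<lhd> \<iota> f = \<iota> f \<rhd> \<theta>"
  using theta_function by simp

lemma theta_normal_at:
  assumes "\<And>n. c n \<in> smooth_functions A"
  shows "\<theta> \<lhd> normal_at \<iota> c N t = shifted \<iota> t \<kappa> c N \<alpha> \<rhd> \<theta>"
  unfolding shifted_def normal_at_def
  by (simp add: ract_sum lact_sum ract_mult theta_embed assms lact_ract theta_power lact_mult)

text \<open>
  Exchanging \<open>u\<close> with \<open>t\<close> produces \<open>\<kappa>\<tau>(u)\<close>, and the differential equation says that this turns the
  function shift by \<open>\<alpha> - \<beta>/u\<close> into the constant shift by \<open>-r\<close>. The equation for \<open>\<mu>\<close> is the case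
  \<open>r = 1\<close>, \<open>u = \<mu>\<close>, and the sum of the equations for \<open>\<mu>\<close> and \<open>\<nu>\<close> is the case \<open>r = 0\<close>, \<open>u = \<mu> + \<nu>\<close>.
\<close>

lemma shift_intertwining:
  assumes u: "u \<in> smooth_functions A" and h: "h \<in> smooth_functions A" and inv: "u * h = 1"
    and ode: "\<tau> u = \<beta> - \<alpha> * u - cst r * u"
  defines "W \<equiv> t + \<iota> (cst \<kappa> * (\<alpha> - \<beta> * h))"
  shows "\<iota> u * W = (t - \<iota> (cst (\<kappa> * r))) * \<iota> u"
    and "\<iota> u * (theta_shift - W) = \<iota> (cst \<kappa> * \<beta>)"
proof -
  have uh: "u * (x * h) = x" for x
    using inv by (metis mult.left_commute mult.right_neutral)
  have kr: "cst (\<kappa> * r) = cst \<kappa> * (cst r :: 'm \<Rightarrow> 'k)"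
    by (simp add: cst_def fun_eq_iff)
  have "u * (cst \<kappa> * (\<alpha> - \<beta> * h)) = cst \<kappa> * (\<alpha> * u - u * (\<beta> * h))"
    by (simp add: algebra_simps)
  then have shift: "u * (cst \<kappa> * (\<alpha> - \<beta> * h)) = cst \<kappa> * (\<alpha> * u - \<beta>)"
    by (simp only: uh)
  have exchange: "\<iota> u * t = t * \<iota> u + \<iota> (cst \<kappa> * \<tau> u)"
    using function_t[OF u] by (simp add: algebra_simps)
  have "cst \<kappa> * \<tau> u = - (cst (\<kappa> * r) * u) - cst \<kappa> * (\<alpha> * u - \<beta>)"
    unfolding ode kr by (simp add: algebra_simps)
  then have tau_u: "\<iota> (cst \<kappa> * \<tau> u) = - \<iota> (cst (\<kappa> * r) * u) - \<iota> (cst \<kappa> * (\<alpha> * u - \<beta>))"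
    by (simp only: embed_diff embed_minus smooth_intros u)
  have shift_u: "\<iota> u * \<iota> (cst \<kappa> * (\<alpha> - \<beta> * h)) = \<iota> (cst \<kappa> * (\<alpha> * u - \<beta>))"
    unfolding shift[symmetric] by (rule embed_mult[symmetric]) (intro smooth_intros u h)+
  show "\<iota> u * W = (t - \<iota> (cst (\<kappa> * r))) * \<iota> u"
    unfolding W_def distrib_left left_diff_distrib exchange tau_u shift_u
      embed_mult[OF smooth_functions_cst u]
    by simp
  have "\<iota> u * (theta_shift - W) = \<iota> u * \<iota> (cst \<kappa> * \<alpha> - cst \<kappa> * (\<alpha> - \<beta> * h))"
    unfolding W_def by (subst embed_diff) (auto intro!: smooth_intros h)
  also have "\<dots> = \<iota> (u * (cst \<kappa> * \<beta> * h))"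
    by (subst embed_mult) (auto intro!: smooth_intros u h simp: algebra_simps)
  also have "\<dots> = \<iota> (cst \<kappa> * \<beta>)"
    by (simp only: uh)
  finally show "\<iota> u * (theta_shift - W) = \<iota> (cst \<kappa> * \<beta>)" .
qed

text \<open>
  Each exchange of \<open>d t\<close> with \<open>t\<close> leaves a multiple of \<open>\<theta>\<close>, through which the remaining powers of
  \<open>t\<close> pass as powers of \<open>t + \<kappa>\<alpha>\<close>. The hypotheses on \<open>u\<close> and \<open>W\<close> make these contributions
  telescope.
\<close>

lemma dt_power:
  assumes "\<iota> u * W = (t - \<iota> (cst \<kappa>)) * \<iota> u" "\<iota> u * (theta_shift - W) = \<iota> (cst \<kappa> * \<beta>)"
  shows "d t \<lhd> t ^ n =
    (t - \<iota> (cst \<kappa>)) ^ n \<rhd> d t + (\<iota> u * (theta_shift ^ n - W ^ n)) \<rhd> \<theta>"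
proof (induction n)
  case 0
  then show ?case
    by (simp add: lact_one ract_one)
next
  case (Suc n)
  have dt: "d t \<lhd> t = (t - \<iota> (cst \<kappa>)) \<rhd> d t + \<iota> (cst \<kappa> * \<beta>) \<rhd> \<theta>"
    using dt_t by (simp add: lact_diff algebra_simps)
  have "d t \<lhd> t ^ Suc n = (d t \<lhd> t ^ n) \<lhd> t"
    by (simp add: power_Suc2 ract_mult del: power_Suc)
  also have "\<dots> = (t - \<iota> (cst \<kappa>)) ^ Suc n \<rhd> d t
      + (\<iota> u * (theta_shift ^ n - W ^ n) * theta_shift
         + (t - \<iota> (cst \<kappa>)) ^ n * \<iota> (cst \<kappa> * \<beta>)) \<rhd> \<theta>"
    unfolding Suc ract_add_left lact_ract dt theta_power[of 1, simplified]
    by (simp only: lact_add lact_add_right lact_mult power_Suc2 add_ac)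
  finally show ?case
    by (simp only: twisted_telescope_Suc[OF assms])
qed

text \<open>
  The derivation \<open>[d t, _] + \<kappa> d\<close> vanishes on functions by their relation with \<open>d t\<close>. Unlike \<open>d\<close>
  it has no \<open>d t\<close> component on \<open>t\<close>, so that its values on all of the algebra are multiples of \<open>\<theta>\<close>.
\<close>

definition inner_defect :: "'a \<Rightarrow> 'w" where
  "inner_defect x = d t \<lhd> x - x \<rhd> d t + \<iota> (cst \<kappa>) \<rhd> d x"

lemma inner_defect_mult:
  assumes "\<iota> (cst \<kappa>) * x = x * \<iota> (cst \<kappa>)"
  shows "inner_defect (x * y) = inner_defect x \<lhd> y + x \<rhd> inner_defect y"
proof -
  have diff: "(w - w') \<lhd> y = w \<lhd> y - w' \<lhd> y" for w w'
    using ract_add_left[of "w - w'" w' y] by (simp add: algebra_simps)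
  have "\<iota> (cst \<kappa>) \<rhd> x \<rhd> d y = x \<rhd> \<iota> (cst \<kappa>) \<rhd> d y"
    using assms by (metis lact_mult)
  then show ?thesis
    unfolding inner_defect_def
    by (simp add: d_mult ract_mult lact_mult ract_add_left lact_add_right lact_diff_right diff
        lact_ract)
qed

lemma inner_defect_function:
  assumes "f \<in> smooth_functions A"
  shows "inner_defect (\<iota> f) = 0"
  using function_dt[OF assms] by (simp add: inner_defect_def algebra_simps)

lemma inner_defect_power:
  assumes "\<iota> s * Z = t * \<iota> s" "\<iota> s * (theta_shift - Z) = \<iota> (cst \<kappa> * \<beta>)"
  shows "inner_defect (t ^ n) = (\<iota> s * (theta_shift ^ n - Z ^ n)) \<rhd> \<theta>"
proof (induction n)
  case 0
  then show ?case
    using inner_defect_function[OF smooth_functions_one] by (simp add: embed_one)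
next
  case (Suc n)
  have dt: "inner_defect t = \<iota> (cst \<kappa> * \<beta>) \<rhd> \<theta>"
    using dt_t by (simp add: inner_defect_def mult.commute)
  have "inner_defect (t ^ Suc n) = inner_defect (t ^ n) \<lhd> t + t ^ n \<rhd> inner_defect t"
    by (simp add: power_Suc2 inner_defect_mult scalar_commute_power del: power_Suc)
  also have "\<dots> = (\<iota> s * (theta_shift ^ n - Z ^ n) * theta_shift
      + t ^ n * \<iota> (cst \<kappa> * \<beta>)) \<rhd> \<theta>"
    unfolding Suc dt lact_ract theta_power[of 1, simplified]
    by (simp add: lact_add lact_mult)
  finally show ?case
    by (simp only: twisted_telescope_Suc[OF assms])
qed

lemma d_zero: "d 0 = 0"
  using d_add[of 0 0] by simp

lemma d_sum: "d (sum f I) = (\<Sum>i\<in>I. d (f i))"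
  by (induction I rule: infinite_finite_induct) (simp_all add: d_add d_zero)

lemma inner_defect_sum: "inner_defect (sum f I) = (\<Sum>i\<in>I. inner_defect (f i))"
  unfolding inner_defect_def
  by (simp add: d_sum ract_sum lact_sum lact_sum_right sum.distrib sum_subtractf)

text \<open>
  Solving the formula for \<open>[d t, t\<^sup>n] + \<kappa> d(t\<^sup>n)\<close> for \<open>d(t\<^sup>n)\<close>: the commutator is known from moving
  \<open>t\<^sup>n\<close> through \<open>d t\<close>.
\<close>

lemma d_power:
  assumes "\<iota> \<mu> * Y = (t - \<iota> (cst \<kappa>)) * \<iota> \<mu>" "\<iota> \<mu> * (theta_shift - Y) = \<iota> (cst \<kappa> * \<beta>)"
    and "\<iota> s * Z = t * \<iota> s" "\<iota> s * (theta_shift - Z) = \<iota> (cst \<kappa> * \<beta>)"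
  shows "d (t ^ n) = \<iota> (cst (1 / \<kappa>)) \<rhd>
    ((t ^ n - (t - \<iota> (cst \<kappa>)) ^ n) \<rhd> d t
     + (\<iota> s * (theta_shift ^ n - Z ^ n) - \<iota> \<mu> * (theta_shift ^ n - Y ^ n)) \<rhd> \<theta>)"
proof -
  have "\<iota> (cst \<kappa>) \<rhd> d (t ^ n) = inner_defect (t ^ n) + t ^ n \<rhd> d t - d t \<lhd> t ^ n"
    by (simp add: inner_defect_def)
  also have "\<dots> = (t ^ n - (t - \<iota> (cst \<kappa>)) ^ n) \<rhd> d t
     + (\<iota> s * (theta_shift ^ n - Z ^ n) - \<iota> \<mu> * (theta_shift ^ n - Y ^ n)) \<rhd> \<theta>"
    by (simp add: inner_defect_power[OF assms(3,4)] dt_power[OF assms(1,2)] lact_diff)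
  finally have "\<iota> (cst (1 / \<kappa>)) \<rhd> \<iota> (cst \<kappa>) \<rhd> d (t ^ n) = \<iota> (cst (1 / \<kappa>)) \<rhd> \<dots>"
    by simp
  then show ?thesis
    using kappa_nonzero by (simp add: lact_mult[symmetric] scalar_mult scalar_one lact_one)
qed

section \<open>The differential of a normal ordered element\<close>

text \<open>
  Since \<open>[d t, _] + \<kappa> d\<close> vanishes on the coefficients, only its values on the powers of \<open>t\<close> enter.
\<close>

lemma commutator_dt_normal_at:
  assumes Z: "\<iota> s * Z = t * \<iota> s" "\<iota> s * (theta_shift - Z) = \<iota> (cst \<kappa> * \<beta>)"
    and s: "s \<in> smooth_functions A" and c: "\<And>n. c n \<in> smooth_functions A"
  shows "d t \<lhd> normal_at \<iota> c N t - normal_at \<iota> c N t \<rhd> d t =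
    - (\<iota> (cst \<kappa>) \<rhd> d (normal_at \<iota> c N t))
    + (\<iota> s * (normal_at \<iota> c N theta_shift - normal_at \<iota> c N Z)) \<rhd> \<theta>"
proof -
  have "inner_defect (normal_at \<iota> c N t) =
      (\<Sum>n\<le>N. \<iota> (c n) \<rhd> (\<iota> s * (theta_shift ^ n - Z ^ n)) \<rhd> \<theta>)"
    unfolding normal_at_def inner_defect_sum
    by (simp add: inner_defect_mult embed_commute smooth_intros c inner_defect_function
        inner_defect_power[OF Z] ract_zero_left)
  also have "\<dots> = (\<iota> s * (normal_at \<iota> c N theta_shift - normal_at \<iota> c N Z)) \<rhd> \<theta>"
    by (simp add: right_diff_distrib function_normal_at s c lact_mult[symmetric]
        lact_sum[symmetric] sum_subtractf[symmetric])
  finally show ?thesis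
    unfolding inner_defect_def by (simp add: algebra_simps)
qed

text \<open>
  The differentials of the coefficients account for the first two summands, and those of the powers of
  \<open>t\<close> for the last one.
\<close>

lemma d_normal_at:
  assumes Y: "\<iota> \<mu> * Y = (t - \<iota> (cst \<kappa>)) * \<iota> \<mu>" "\<iota> \<mu> * (theta_shift - Y) = \<iota> (cst \<kappa> * \<beta>)"
    and Z: "\<iota> s * Z = t * \<iota> s" "\<iota> s * (theta_shift - Z) = \<iota> (cst \<kappa> * \<beta>)"
    and smooth: "\<mu> \<in> smooth_functions A" "s \<in> smooth_functions A"
    and c: "\<And>n. c n \<in> smooth_functions A"
  shows "d (normal_at \<iota> c N t) =
    (\<Sum>n\<le>N. j (ext_deriv A (c n)) \<lhd> t ^ n)
    + \<iota> (cst (\<kappa> / 2)) \<rhd> (\<theta> \<lhd> normal_at \<iota> (\<lambda>n. zeta_laplacian A g \<zeta> (c n)) N t)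
    + \<iota> (cst (1 / \<kappa>)) \<rhd>
      ((normal_at \<iota> c N t - normal_at \<iota> c N (t - \<iota> (cst \<kappa>))) \<rhd> d t
       + (\<iota> s * (normal_at \<iota> c N theta_shift - normal_at \<iota> c N Z)
          - \<iota> \<mu> * (normal_at \<iota> c N theta_shift - normal_at \<iota> c N Y)) \<rhd> \<theta>)"
proof -
  let ?P = "\<lambda>n. t ^ n - (t - \<iota> (cst \<kappa>)) ^ n"
  let ?Q = "\<lambda>n. \<iota> s * (theta_shift ^ n - Z ^ n) - \<iota> \<mu> * (theta_shift ^ n - Y ^ n)"
  have laplacian: "(\<iota> (cst (\<kappa> / 2) * zeta_laplacian A g \<zeta> (c n)) \<rhd> \<theta>) \<lhd> t ^ n
      = \<iota> (cst (\<kappa> / 2)) \<rhd> \<theta> \<lhd> (\<iota> (zeta_laplacian A g \<zeta> (c n)) * t ^ n)" for n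
    by (simp add: embed_mult smooth_intros c ract_mult theta_embed lact_mult lact_ract)
  have "\<iota> (c n) \<rhd> \<iota> (cst (1 / \<kappa>)) \<rhd> w = \<iota> (cst (1 / \<kappa>)) \<rhd> \<iota> (c n) \<rhd> w" for n w
    by (metis lact_mult embed_commute smooth_functions_cst c)
  then have polynomial: "\<iota> (c n) \<rhd> d (t ^ n) =
      \<iota> (cst (1 / \<kappa>)) \<rhd> ((\<iota> (c n) * ?P n) \<rhd> d t + (\<iota> (c n) * ?Q n) \<rhd> \<theta>)" for n
    unfolding d_power[OF Y Z] by (simp add: lact_add_right lact_mult)
  have P: "(\<Sum>n\<le>N. \<iota> (c n) * ?P n) = normal_at \<iota> c N t - normal_at \<iota> c N (t - \<iota> (cst \<kappa>))"
    by (simp add: normal_at_def right_diff_distrib sum_subtractf)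
  have Q: "(\<Sum>n\<le>N. \<iota> (c n) * ?Q n) =
      \<iota> s * (normal_at \<iota> c N theta_shift - normal_at \<iota> c N Z)
      - \<iota> \<mu> * (normal_at \<iota> c N theta_shift - normal_at \<iota> c N Y)"
    by (simp add: right_diff_distrib function_normal_at smooth c sum_subtractf)
  have "d (normal_at \<iota> c N t) = (\<Sum>n\<le>N. d (\<iota> (c n)) \<lhd> t ^ n + \<iota> (c n) \<rhd> d (t ^ n))"
    by (simp add: normal_at_def d_sum d_mult)
  also have "\<dots> = (\<Sum>n\<le>N. j (ext_deriv A (c n)) \<lhd> t ^ n)
      + (\<Sum>n\<le>N. \<iota> (cst (\<kappa> / 2)) \<rhd> \<theta> \<lhd> (\<iota> (zeta_laplacian A g \<zeta> (c n)) * t ^ n))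
      + (\<Sum>n\<le>N. \<iota> (cst (1 / \<kappa>)) \<rhd> ((\<iota> (c n) * ?P n) \<rhd> d t + (\<iota> (c n) * ?Q n) \<rhd> \<theta>))"
    unfolding polynomial d_function[OF c] ract_add_left laplacian
    by (simp add: sum.distrib)
  also have "(\<Sum>n\<le>N. \<iota> (cst (\<kappa> / 2)) \<rhd> \<theta> \<lhd> (\<iota> (zeta_laplacian A g \<zeta> (c n)) * t ^ n))
      = \<iota> (cst (\<kappa> / 2)) \<rhd> (\<theta> \<lhd> normal_at \<iota> (\<lambda>n. zeta_laplacian A g \<zeta> (c n)) N t)"
    by (simp add: normal_at_def ract_sum lact_sum_right)
  also have "(\<Sum>n\<le>N. \<iota> (cst (1 / \<kappa>)) \<rhd> ((\<iota> (c n) * ?P n) \<rhd> d t + (\<iota> (c n) * ?Q n) \<rhd> \<theta>))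
      = \<iota> (cst (1 / \<kappa>)) \<rhd> ((\<Sum>n\<le>N. \<iota> (c n) * ?P n) \<rhd> d t + (\<Sum>n\<le>N. \<iota> (c n) * ?Q n) \<rhd> \<theta>)"
    by (simp only: lact_sum_right[symmetric] lact_sum sum.distrib)
  finally show ?thesis
    unfolding P Q .
qed

end

lemma invertible_function_inverse:
  assumes "invertible_function A f"
  obtains h where "h \<in> smooth_functions A" "f * h = 1" "\<And>b p. b p / f p = (b * h) p"
proof -
  obtain h where h: "h \<in> smooth_functions A" "f * h = 1"
    using assms by (auto simp: invertible_function_def)
  have "b p / f p = (b * h) p" for b p
  proof -
    have "f p * h p = 1"
      using fun_cong[OF h(2), of p] by simp
    then have "f p \<noteq> 0" "f p * h p = 1"
      by auto
    then show ?thesis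
      by (simp add: field_simps)
  qed
  with h that show thesis
    by blast
qed

theorem proposition3p3:
  fixes A :: "('m::{t2_space,second_countable_topology}, 'n::finite) chart set"
    and g :: "('m, 'k::real_normed_field) metric"
    and \<zeta> \<tau> :: "('m, 'k) vfield"
    and \<alpha> \<beta> \<mu> \<nu> :: "'m \<Rightarrow> 'k"
    and \<kappa> :: 'k
    and \<iota> :: "('m \<Rightarrow> 'k) \<Rightarrow> 'a::ring_1"
    and t :: 'a
    and lact :: "'a \<Rightarrow> 'w::ab_group_add \<Rightarrow> 'w" (infixr "\<rhd>" 72)
    and ract :: "'w \<Rightarrow> 'a \<Rightarrow> 'w" (infixl "\<lhd>" 73)
    and j :: "('m, 'k) form \<Rightarrow> 'w"
    and \<theta> :: 'w
    and d :: "'a \<Rightarrow> 'w"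
    and c :: "nat \<Rightarrow> 'm \<Rightarrow> 'k"
    and N :: nat
  assumes "smooth_atlas A"
    and "riemannian_metric A g"
    and "\<zeta> \<in> vector_fields A"
    and "\<beta> \<in> smooth_functions A"
    and "conformal_killing A g \<tau>"
    and "\<kappa> \<noteq> 0"
    and "semidirect_algebra A \<tau> \<kappa> \<iota> t"
    and "semidirect_calculus (\<rhd>) (\<lhd>) A g \<zeta> \<tau> \<beta> \<kappa> \<iota> t j \<theta> d"
    and "\<alpha> = conf_alpha A g \<tau>"
    and "\<mu> \<in> smooth_functions A"
    and "\<nu> \<in> smooth_functions A"
    and "invertible_function A \<mu>"
    and "invertible_function A (\<mu> + \<nu>)"
    and "\<tau> \<mu> = \<beta> - (1 + \<alpha>) * \<mu>"
    and "\<tau> \<nu> = \<mu> - \<alpha> * \<nu>"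
    and "\<And>n. c n \<in> smooth_functions A"
  shows "(\<theta> \<lhd> normal_at \<iota> c N t = shifted \<iota> t \<kappa> c N \<alpha> \<rhd> \<theta>) \<and>
         (d (normal_at \<iota> c N t) =
           (\<Sum>n\<le>N. j (ext_deriv A (c n)) \<lhd> t ^ n)
           + \<iota> (cst (\<kappa> / 2)) \<rhd> (\<theta> \<lhd> normal_at \<iota> (\<lambda>n. zeta_laplacian A g \<zeta> (c n)) N t)
           + partial0 \<iota> t \<kappa> c N \<rhd> d t
           + \<iota> (cst \<kappa>) \<rhd> (Delta0 \<iota> t \<kappa> \<alpha> \<beta> \<mu> \<nu> c N \<rhd> \<theta>)) \<and>
         (d t \<lhd> normal_at \<iota> c N t - normal_at \<iota> c N t \<rhd> d t =
           - (\<iota> (cst \<kappa>) \<rhd> d (normal_at \<iota> c N t))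
           + \<iota> (cst \<kappa> * (\<mu> + \<nu>)) \<rhd> (\<iota> (cst (1 / \<kappa>)) *
               (shifted \<iota> t \<kappa> c N \<alpha>
                - shifted \<iota> t \<kappa> c N (\<lambda>p. \<alpha> p - \<beta> p / (\<mu> p + \<nu> p)))) \<rhd> \<theta>)"
proof -
  have tau: "\<tau> \<in> vector_fields A"
    using assms(5) by (simp add: conformal_killing_def)
  interpret semidirect_algebra A \<tau> \<kappa> \<iota> t
    by fact
  interpret semidirect_calculus lact ract A g \<zeta> \<tau> \<beta> \<kappa> \<iota> t j \<theta> d
    by fact
  interpret manifold_calculus lact ract A g \<zeta> \<tau> \<beta> \<kappa> \<iota> t j \<theta> d
    by unfold_locales (fact tau assms)+
  note c = assms(16) and alpha = assms(9)
  let ?s = "\<mu> + \<nu>"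
  have s: "?s \<in> smooth_functions A"
    by (intro smooth_intros assms)
  obtain h where h: "h \<in> smooth_functions A" "\<mu> * h = 1" "\<And>b p. b p / \<mu> p = (b * h) p"
    using assms(12) by (rule invertible_function_inverse) blast
  obtain l where l: "l \<in> smooth_functions A" "?s * l = 1" "\<And>b p. b p / ?s p = (b * l) p"
    using assms(13) by (rule invertible_function_inverse) blast
  define X where "X = t + \<iota> (cst \<kappa> * \<alpha>)"
  define Y where "Y = t + \<iota> (cst \<kappa> * (\<alpha> - \<beta> * h))"
  define Z where "Z = t + \<iota> (cst \<kappa> * (\<alpha> - \<beta> * l))"
  have mu_ode: "\<tau> \<mu> = \<beta> - \<alpha> * \<mu> - cst 1 * \<mu>"
    unfolding assms(14) by (simp add: cst_def fun_eq_iff algebra_simps)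
  have "\<tau> ?s = \<tau> \<mu> + \<tau> \<nu>"
    by (rule vector_field_add[OF tau assms(10,11)])
  then have s_ode: "\<tau> ?s = \<beta> - \<alpha> * ?s - cst 0 * ?s"
    unfolding assms(14,15) by (simp add: cst_def fun_eq_iff algebra_simps)
  have Y: "\<iota> \<mu> * Y = (t - \<iota> (cst \<kappa>)) * \<iota> \<mu>" "\<iota> \<mu> * (X - Y) = \<iota> (cst \<kappa> * \<beta>)"
    using shift_intertwining[OF assms(10) h(1,2), of 1] mu_ode
    by (simp_all add: X_def Y_def alpha)
  have zero: "\<iota> (cst 0) = 0"
    using embed_zero by (simp add: cst_def zero_fun_def)
  have Z: "\<iota> ?s * Z = t * \<iota> ?s" "\<iota> ?s * (X - Z) = \<iota> (cst \<kappa> * \<beta>)"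
    using shift_intertwining[OF s l(1,2), of 0] s_ode
    by (simp_all add: X_def Z_def alpha zero)
  have shift_X: "shifted \<iota> t \<kappa> c N \<alpha> = normal_at \<iota> c N X"
    by (simp add: shifted_def X_def)
  have shift_Y: "shifted \<iota> t \<kappa> c N (\<lambda>p. - (\<beta> p / \<mu> p - \<alpha> p)) = normal_at \<iota> c N Y"
  proof -
    have "(\<lambda>p. - (\<beta> p / \<mu> p - \<alpha> p)) = \<alpha> - \<beta> * h"
      by (simp add: fun_eq_iff h(3))
    then show ?thesis
      by (simp add: shifted_def Y_def)
  qed
  have shift_Z: "shifted \<iota> t \<kappa> c N (\<lambda>p. \<alpha> p - \<beta> p / (\<mu> p + \<nu> p)) = normal_at \<iota> c N Z"
  proof -
    have "(\<lambda>p. \<alpha> p - \<beta> p / (\<mu> p + \<nu> p)) = \<alpha> - \<beta> * l"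
      using l(3)[of \<beta>] by (simp add: fun_eq_iff)
    then show ?thesis
      by (simp add: shifted_def Z_def)
  qed
  have shift_t: "shifted \<iota> t \<kappa> c N (- 1) = normal_at \<iota> c N (t - \<iota> (cst \<kappa>))"
    by (simp add: shifted_def embed_minus smooth_intros)
  let ?f = "normal_at \<iota> c N"
  have Delta0: "Delta0 \<iota> t \<kappa> \<alpha> \<beta> \<mu> \<nu> c N =
      \<iota> (cst (1 / \<kappa>\<^sup>2)) * (\<iota> ?s * (?f X - ?f Z) - \<iota> \<mu> * (?f X - ?f Y))"
    unfolding Delta0_def shift_X shift_Y add.commute[of "\<nu> _"] add.commute[of \<nu>] shift_Z
    by (simp add: embed_add assms(10,11) algebra_simps)
  have "\<theta> \<lhd> ?f t = shifted \<iota> t \<kappa> c N \<alpha> \<rhd> \<theta>"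
    using theta_normal_at[OF c] by (simp add: alpha)
  moreover have "d (?f t) =
      (\<Sum>n\<le>N. j (ext_deriv A (c n)) \<lhd> t ^ n)
      + \<iota> (cst (\<kappa> / 2)) \<rhd> (\<theta> \<lhd> normal_at \<iota> (\<lambda>n. zeta_laplacian A g \<zeta> (c n)) N t)
      + partial0 \<iota> t \<kappa> c N \<rhd> d t
      + \<iota> (cst \<kappa>) \<rhd> (Delta0 \<iota> t \<kappa> \<alpha> \<beta> \<mu> \<nu> c N \<rhd> \<theta>)"
  proof -
    have "\<kappa> * (1 / \<kappa>\<^sup>2) = 1 / \<kappa>"
      using assms(6) by (simp add: power2_eq_square)
    then have "\<iota> (cst \<kappa>) \<rhd> (Delta0 \<iota> t \<kappa> \<alpha> \<beta> \<mu> \<nu> c N \<rhd> \<theta>) =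
        \<iota> (cst (1 / \<kappa>)) \<rhd> (\<iota> ?s * (?f X - ?f Z) - \<iota> \<mu> * (?f X - ?f Y)) \<rhd> \<theta>"
      unfolding Delta0 by (simp only: lact_mult[symmetric] mult.assoc[symmetric] scalar_mult)
    moreover have "partial0 \<iota> t \<kappa> c N \<rhd> d t =
        \<iota> (cst (1 / \<kappa>)) \<rhd> (?f t - ?f (t - \<iota> (cst \<kappa>))) \<rhd> d t"
      unfolding partial0_def shift_t by (simp only: lact_mult)
    ultimately show ?thesis
      using d_normal_at[OF Y[unfolded X_def alpha] Z[unfolded X_def alpha] assms(10) s c, where N = N]
      by (simp only: X_def alpha lact_add_right add.assoc)
  qed
  moreover have "d t \<lhd> ?f t - ?f t \<rhd> d t =
      - (\<iota> (cst \<kappa>) \<rhd> d (?f t))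
      + \<iota> (cst \<kappa> * ?s) \<rhd> (\<iota> (cst (1 / \<kappa>)) *
          (shifted \<iota> t \<kappa> c N \<alpha>
           - shifted \<iota> t \<kappa> c N (\<lambda>p. \<alpha> p - \<beta> p / (\<mu> p + \<nu> p)))) \<rhd> \<theta>"
  proof -
    have "cst \<kappa> * ?s * cst (1 / \<kappa>) = ?s"
      using assms(6) by (simp add: cst_def fun_eq_iff)
    then have "\<iota> (cst \<kappa> * ?s) * \<iota> (cst (1 / \<kappa>)) = \<iota> ?s"
      by (metis embed_mult smooth_functions_mult[OF assms(1)] smooth_functions_cst s)
    then have "\<iota> (cst \<kappa> * ?s) \<rhd> (\<iota> (cst (1 / \<kappa>)) * (?f X - ?f Z)) \<rhd> \<theta>
        = (\<iota> ?s * (?f X - ?f Z)) \<rhd> \<theta>"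
      by (simp only: lact_mult[symmetric] mult.assoc[symmetric])
    then show ?thesis
      using commutator_dt_normal_at[OF Z[unfolded X_def alpha] s c, where N = N]
      unfolding shift_X shift_Z by (simp only: X_def alpha)
  qed
  ultimately show ?thesis
    by blast
qed

end
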